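(* Let $C \in SO(3)$ be any element. Then for Lebesgue almost every $(\alpha,\beta,\gamma) \in \mathbb T^3$ there is a constant $D=D(\alpha,\beta,\gamma)>0$ such that $$\min_{\{\mathcal I_m:\ |\mathcal I_m|=n\}} \|W_{\mathcal I_m}(\alpha,\beta,\gamma)-C\|\ \geq\ D^{-n^2}\qquad \text{for all } n \in \mathbb Z_+,$$ where the minimum is over all multi-indices $\mathcal I_m$ (with $m\ge 1$ arbitrary) satisfying $|\mathcal I_m|=n$.
   Context: $\mathbb T=\mathbb R/2\pi\mathbb Z$ and $\mathbb Z_+$ is the set of positive integers. For $(\alpha,\beta,\gamma)\in\mathbb T^3$ let $A\in SO(3)$ be the rotation of $\mathbb R^3$ by angle $\alpha$ about the $x$-axis (direction $v_A=(1,0,0)$), and let $B\in SO(3)$ be the rotation by angle $\beta$ about the axis $v_B$ lying in the $(x,y)$-plane and forming angle $\gamma$ with $v_A$ in the clockwise direction, i.e. $v_B=(\cos\gamma,-\sin\gamma,0)$. For $m\geq 1$, a multi-index $\mathcal I_m=(s_1,r_1,\dots,s_m,r_m)$ is a $2m$-tuple of nonzero integers (of either sign). Its length is $|\mathcal I_m|=\sum_{p=1}^m(|s_p|+|r_p|)$, and $W_{\mathcal I_m}(\alpha,\beta,\gamma)=A^{s_1}B^{r_1}A^{s_2}B^{r_2}\cdots A^{s_m}B^{r_m}\in SO(3)$ for these $A,B$. $\|\cdot\|$ is a fixed norm on real $3\times 3$ matrices (e.g. the operator norm; the choice does not affect the statement). The minimum over an empty set (the case $n=1$) is taken to be $+\infty$,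 i.e. the inequality is required for every word with $|\mathcal I_m|=n$. *)

theory Defs
  imports "HOL-Analysis.Analysis"
begin

text \<open>Rodrigues' formula: for a unit vector \<open>u\<close>, the rotation by the angle \<open>t\<close> about the axis
  directed by \<open>u\<close>, oriented by the right-hand rule.\<close>

definition axis_rotation :: "real^3 \<Rightarrow> real \<Rightarrow> real^3^3" where
  "axis_rotation u t =
     matrix (\<lambda>x. cos t *\<^sub>R x + sin t *\<^sub>R cross3 u x + ((1 - cos t) * (u \<bullet> x)) *\<^sub>R u)"

definition axis_A :: "real^3" where
  "axis_A = vector [1, 0, 0]"

definition axis_B :: "real \<Rightarrow> real^3" where
  "axis_B \<gamma> = vector [cos \<gamma>, - sin \<gamma>, 0]"

text \<open>The library's \<open>^\<close> on \<open>real^3^3\<close> is the componentwise power, so powers with respect to the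
  matrix product \<open>**\<close> are defined here.\<close>

definition matrix_powi :: "real^3^3 \<Rightarrow> int \<Rightarrow> real^3^3" where
  "matrix_powi M k =
     (if k \<ge> 0 then (((**) M) ^^ nat k) (mat 1)
      else (((**) (matrix_inv M)) ^^ nat (- k)) (mat 1))"

text \<open>The multi-index \<open>(s\<^sub>1, r\<^sub>1, \<dots>, s\<^sub>m, r\<^sub>m)\<close> is the list
  \<open>[(s\<^sub>1, r\<^sub>1), \<dots>, (s\<^sub>m, r\<^sub>m)]\<close>.\<close>

definition multi_indices :: "(int \<times> int) list set" where
  "multi_indices = {I. I \<noteq> [] \<and> (\<forall>(s, r) \<in> set I. s \<noteq> 0 \<and> r \<noteq> 0)}"

definition multi_length :: "(int \<times> int) list \<Rightarrow> nat" where
  "multi_length I = (\<Sum>(s, r) \<leftarrow> I. nat \<bar>s\<bar> + nat \<bar>r\<bar>)"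

fun matrix_word :: "real^3^3 \<Rightarrow> real^3^3 \<Rightarrow> (int \<times> int) list \<Rightarrow> real^3^3" where
  "matrix_word A B [] = mat 1"
| "matrix_word A B ((s, r) # I) = matrix_powi A s ** matrix_powi B r ** matrix_word A B I"

definition W :: "(int \<times> int) list \<Rightarrow> real \<Rightarrow> real \<Rightarrow> real \<Rightarrow> real^3^3" where
  "W I \<alpha> \<beta> \<gamma> = matrix_word (axis_rotation axis_A \<alpha>) (axis_rotation (axis_B \<gamma>) \<beta>) I"

definition matrix_norm :: "(real^3^3 \<Rightarrow> real) \<Rightarrow> bool" where
  "matrix_norm N \<longleftrightarrow>
     (\<forall>M. N M \<ge> 0) \<and> (\<forall>M. N M = 0 \<longleftrightarrow> M = 0) \<and>
     (\<forall>c M. N (c *\<^sub>R M) = \<bar>c\<bar> * N M) \<and> (\<forall>L M. N (L + M) \<le> N L + N M)"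

text \<open>Lebesgue measure on the torus \<open>(\<real>/2\<pi>\<int>)\<^sup>3\<close>, carried by the fundamental domain
  \<open>[0,2\<pi>)\<^sup>3\<close>, which contains exactly one representative of every point.\<close>

definition torus3 :: "(real \<times> real \<times> real) measure" where
  "torus3 = lebesgue_on ({0..<2*pi} \<times> {0..<2*pi} \<times> {0..<2*pi})"

lemma axis_rotation_nth:
  "axis_rotation u t = vector
    [vector [cos t + (1 - cos t) * u$1 * u$1, (1 - cos t) * u$1 * u$2 - sin t * u$3,
             (1 - cos t) * u$1 * u$3 + sin t * u$2],
     vector [(1 - cos t) * u$2 * u$1 + sin t * u$3, cos t + (1 - cos t) * u$2 * u$2,
             (1 - cos t) * u$2 * u$3 - sin t * u$1],
     vector [(1 - cos t) * u$3 * u$1 - sin t * u$2, (1 - cos t) * u$3 * u$2 + sin t * u$1,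
             cos t + (1 - cos t) * u$3 * u$3]]"
  by (simp add: axis_rotation_def matrix_def vec_eq_iff forall_3 cross3_def axis_def
      inner_vec_def sum_3 algebra_simps)

lemma norm_axis_A: "norm axis_A = 1"
  by (simp add: axis_A_def norm_eq_1 inner_vec_def sum_3)

lemma norm_axis_B: "norm (axis_B \<gamma>) = 1"
  by (simp add: axis_B_def norm_eq_1 inner_vec_def sum_3 flip: power2_eq_square)

lemma rotation_axis_A:
  "axis_rotation axis_A t =
     vector [vector [1, 0, 0], vector [0, cos t, - sin t], vector [0, sin t, cos t]]"
  by (simp add: axis_rotation_nth axis_A_def)

lemma axis_rotation_add:
  assumes "norm u = 1"
  shows "axis_rotation u (s + t) = axis_rotation u s ** axis_rotation u t"
proof -
  define a b c where "a = u$1" and "b = u$2" and "c = u$3"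
  have "a\<^sup>2 + b\<^sup>2 + c\<^sup>2 = 1"
    using assms by (simp add: norm_eq_1 inner_vec_def sum_3 a_def b_def c_def power2_eq_square)
  then show ?thesis
    apply (simp add: axis_rotation_nth vec_eq_iff forall_3 matrix_matrix_mult_def sum_3
        cos_add sin_add flip: a_def b_def c_def)
    apply (intro conjI; algebra)
    done
qed

lemma rotation_matrix_axis_rotation:
  assumes "norm u = 1"
  shows "rotation_matrix (axis_rotation u t)"
proof -
  have "axis_rotation u 0 = mat 1"
    by (simp add: axis_rotation_nth vec_eq_iff forall_3 mat_def)
  moreover have "transpose (axis_rotation u t) = axis_rotation u (- t)" for t
    by (simp add: axis_rotation_nth vec_eq_iff forall_3 transpose_def algebra_simps)
  ultimately have orth: "orthogonal_matrix (axis_rotation u t)" for t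
    using axis_rotation_add[OF assms, of "- t" t] by (simp add: orthogonal_matrix)
  have "det (axis_rotation u t) = det (axis_rotation u (t/2)) * det (axis_rotation u (t/2))"
    using axis_rotation_add[OF assms, of "t/2" "t/2"] by (simp add: det_mul)
  also have "\<dots> = 1"
    using det_orthogonal_matrix[OF orth[of "t/2"]] by auto
  finally show ?thesis
    using orth by (simp add: rotation_matrix_def)
qed

lemma axis_rotation_periodic: "axis_rotation u (t + 2 * pi) = axis_rotation u t"
  by (simp add: axis_rotation_def)

lemma axis_B_periodic: "axis_B (\<gamma> + 2 * pi) = axis_B \<gamma>"
  by (simp add: axis_B_def)

end

theory Submission
  imports Defs "HOL-Computational_Algebra.Fundamental_Theorem_Algebra"
begin

text \<open>Fix \<open>\<alpha>\<close> and \<open>\<beta>\<close>. The entries of the word \<open>W\<close> with \<open>m\<close> syllables \<open>A\<^sup>s B\<^sup>r\<close> are trigonometric polynomials in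
  \<open>\<gamma>\<close>. The idea is to look at their extreme Fourier coefficient, of frequency \<open>2m\<close>. In it only the
  rank-one parts \<open>(1 - cos (r \<beta>))/4 \<cdot> w w\<^sup>T\<close> of the rotations \<open>B\<^sup>r\<close> survive, where \<open>w = (1, \<i>, 0)\<close>, and
  between two of them stands the number \<open>w\<^sup>T A\<^sup>s w = 1 - cos (s \<alpha>)\<close>. So the combination
  \<open>W\<^sub>1\<^sub>1 + \<i> W\<^sub>2\<^sub>1\<close> has the extreme coefficient \<open>\<Prod> (1 - cos (s \<alpha>)) (1 - cos (r \<beta>)) / 4\<close>, the product running
  over all syllables (\<open>poly_W\<close>). Subtracting \<open>C\<close> changes only the frequency \<open>0\<close>, so no choice of \<open>C\<close>
  can affect this coefficient (\<open>poly_W_minus\<close>).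

  For almost every angle \<open>t\<close> the numbers \<open>1 - cos (k t)\<close> are at least \<open>D\<close> to the power \<open>-k\<^sup>2\<close>
  (\<open>AE_one_minus_cos_lower_bound\<close>). Because the squares of the exponents of a word of length \<open>n\<close> add up
  to at most \<open>n\<^sup>2\<close>, for almost all \<open>(\<alpha>, \<beta>)\<close> the extreme coefficient is at least a constant to the power
  \<open>-n\<^sup>2\<close> (\<open>leading_coeff_lower_bound\<close>).

  A polynomial of degree \<open>d\<close> with leading coefficient \<open>a\<close> satisfies \<open>\<bar>p (e\<^sup>i\<^sup>t)\<bar> < \<bar>a\<bar> \<rho>\<^sup>d\<close> only near one of its
  \<open>d\<close> roots, on a set of measure \<open>O(d \<rho>)\<close> (\<open>emeasure_sublevel_le\<close>). There are at most \<open>3\<^sup>n\<close> words of length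
  \<open>n\<close>, and their polynomials have degree \<open>4m \<le> 2n\<close>. With \<open>\<rho>\<close> proportional to \<open>4\<^sup>-\<^sup>n\<close> the exceptional sets
  are summable, and the lower bound \<open>\<bar>a\<bar> \<rho>\<^sup>d\<close> is again exponential in \<open>n\<^sup>2\<close>
  (\<open>AE_poly_family_lower_bound\<close>). Fubini's theorem combines the three angles, and the equivalence of
  norms replaces \<open>W\<^sub>1\<^sub>1 + \<i> W\<^sub>2\<^sub>1\<close> by the given norm.\<close>

section \<open>Small values of polynomials on the unit circle\<close>

lemma sin_ge_third:
  fixes x :: real
  assumes "0 \<le> x" "x \<le> 2"
  shows "x / 3 \<le> sin x"
proof -
  have "\<bar>sin x - (\<Sum>m<3. sin_coeff m * x ^ m)\<bar> \<le> inverse (fact 3) * \<bar>x\<bar> ^ 3"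
    by (rule Maclaurin_sin_bound)
  then have "\<bar>sin x - x\<bar> \<le> x ^ 3 / 6"
    using assms by (simp add: eval_nat_numeral lessThan_Suc sin_coeff_def fact_numeral)
  moreover have "x ^ 3 \<le> 4 * x"
    using assms mult_right_mono[of "x * x" 4 x] mult_mono[of x 2 x 2]
    by (simp add: power3_eq_cube)
  ultimately show ?thesis
    by linarith
qed

lemma cmod_cis_diff: "cmod (cis s - cis t) = 2 * \<bar>sin ((s - t) / 2)\<bar>"
proof -
  have "(cmod (cis s - cis t))\<^sup>2 = (cos s - cos t)\<^sup>2 + (sin s - sin t)\<^sup>2"
    by (simp add: cmod_power2)
  also have "\<dots> = 2 - 2 * cos (s - t)"
    using sin_cos_squared_add[of s] sin_cos_squared_add[of t]
    by (simp add: cos_diff power2_diff algebra_simps)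
  also have "cos (s - t) = 1 - 2 * (sin ((s - t) / 2))\<^sup>2"
    using cos_double_sin[of "(s - t) / 2"] by (simp only: mult_2 field_sum_of_halves)
  also have "2 - 2 * (1 - 2 * (sin ((s - t) / 2))\<^sup>2) = (2 * \<bar>sin ((s - t) / 2)\<bar>)\<^sup>2"
    by (simp add: power_mult_distrib)
  finally show ?thesis
    by (subst (asm) power2_eq_iff_nonneg) auto
qed

text \<open>The set lies within distance \<open>2\<rho>\<close> (along chords) of any one of its points, and
  on the circle an arc is at most three times as long as its chord. The interval \<open>[0, 2\<pi>)\<close> cuts
  the resulting arc at the point \<open>1\<close>, which is why the two ends of the interval are added to the
  neighbourhood of the chosen point; the constant \<open>24\<close> is crude.\<close>

lemma emeasure_arc_le:
  assumes "0 \<le> \<rho>"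
  shows "emeasure lborel {t\<in>{0..<2*pi}. cmod (cis t - z) < \<rho>} \<le> ennreal (24 * \<rho>)"
proof (cases "{t\<in>{0..<2*pi}. cmod (cis t - z) < \<rho>} = {}")
  case False
  then obtain t0 where t0: "0 \<le> t0" "t0 < 2*pi" "cmod (cis t0 - z) < \<rho>"
    by auto
  have "{t\<in>{0..<2*pi}. cmod (cis t - z) < \<rho>}
      \<subseteq> {t0 - 6*\<rho>..t0 + 6*\<rho>} \<union> ({0..6*\<rho>} \<union> {2*pi - 6*\<rho>..2*pi})" (is "_ \<subseteq> ?R")
  proof
    fix t assume "t \<in> {t\<in>{0..<2*pi}. cmod (cis t - z) < \<rho>}"
    then have t: "0 \<le> t" "t < 2*pi" "cmod (cis t - z) < \<rho>"
      by auto
    have "cmod (cis t - cis t0) \<le> cmod (cis t - z) + cmod (cis t0 - z)"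
      by (rule norm_diff_triangle_le[OF order_refl]) (simp add: norm_minus_commute)
    then have sin_lt: "\<bar>sin ((t - t0) / 2)\<bar> < \<rho>"
      using t t0 by (simp add: cmod_cis_diff)
    define x where "x = \<bar>(t - t0) / 2\<bar>"
    then have "\<bar>sin ((t - t0) / 2)\<bar> = \<bar>sin x\<bar>"
      unfolding abs_if[of "(t - t0) / 2"] by (simp only: sin_minus abs_minus_cancel split: if_split) simp
    moreover have x_eq: "2 * x = \<bar>t - t0\<bar>"
      by (simp add: x_def)
    then have x: "0 \<le> x" "x < pi"
      using t t0 by linarith+
    ultimately have "sin x < \<rho>"
      using sin_lt by simp
    have "x \<le> 3 * \<rho> \<or> pi - x \<le> 3 * \<rho>"
    proof (cases "x \<le> pi / 2")
      case True
      then have "x / 3 \<le> sin x"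
        using x pi_half_less_two by (intro sin_ge_third) auto
      with \<open>sin x < \<rho>\<close> show ?thesis by simp
    next
      case False
      then have "(pi - x) / 3 \<le> sin (pi - x)"
        using x pi_half_less_two by (intro sin_ge_third) auto
      with \<open>sin x < \<rho>\<close> show ?thesis by simp
    qed
    then show "t \<in> ?R"
      using t t0 x_eq by (simp; linarith)
  qed
  then have "emeasure lborel {t\<in>{0..<2*pi}. cmod (cis t - z) < \<rho>} \<le> emeasure lborel ?R"
    by (intro emeasure_mono) auto
  also have "\<dots> \<le> emeasure lborel {t0 - 6*\<rho>..t0 + 6*\<rho>} +
      (emeasure lborel {0..6*\<rho>} + emeasure lborel {2*pi - 6*\<rho>..2*pi})"
    by (intro order_trans[OF emeasure_subadditive] add_left_mono) auto
  also have "\<dots> = ennreal (24 * \<rho>)"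
    using assms by (simp flip: ennreal_plus)
  finally show ?thesis .
qed (simp only: emeasure_empty zero_le)

text \<open>The threshold is written as \<open>\<bar>a\<bar> \<rho>\<^sup>d\<close>, with \<open>a\<close> the leading coefficient and \<open>d\<close> the degree,
  because \<open>\<rho>\<close> is then the radius around the roots that has to be removed.\<close>

definition sublevel :: "complex poly \<Rightarrow> real \<Rightarrow> real set" where
  "sublevel p \<rho> = {t\<in>{0..<2*pi}. cmod (poly p (cis t)) < cmod (lead_coeff p) * \<rho> ^ degree p}"

lemma borel_measurable_poly_cis [measurable]: "(\<lambda>t. poly p (cis t)) \<in> borel_measurable borel"
  by (intro borel_measurable_continuous_onI continuous_intros)

lemma borel_measurable_cis [measurable]: "cis \<in> borel_measurable borel"
  by (intro borel_measurable_continuous_onI continuous_intros)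

lemma sets_sublevel [measurable]: "sublevel p \<rho> \<in> sets borel"
  unfolding sublevel_def by measurable

text \<open>If every one of the \<open>d\<close> roots is at distance at least \<open>\<rho>\<close> from \<open>e\<^sup>i\<^sup>t\<close>, the factorisation into linear
  factors gives \<open>\<bar>p (e\<^sup>i\<^sup>t)\<bar> \<ge> \<bar>a\<bar> \<rho>\<^sup>d\<close>. So the sublevel set is covered by \<open>d\<close> arcs of length
  proportional to \<open>\<rho>\<close>; the induction splits off one root at a time.\<close>

lemma emeasure_sublevel_le:
  assumes "0 \<le> \<rho>"
  shows "emeasure lborel (sublevel p \<rho>) \<le> ennreal (24 * \<rho> * degree p)"
proof (induction "degree p" arbitrary: p)
  case 0
  then obtain a where "p = [:a:]"
    by (metis degree_eq_zeroE)
  then have "sublevel p \<rho> = {}"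
    by (simp add: sublevel_def)
  then show ?case by simp
next
  case (Suc d)
  then have "\<not> constant (poly p)"
    by (simp add: constant_degree)
  then obtain z where "poly p z = 0"
    using fundamental_theorem_of_algebra by blast
  then obtain q where p: "p = [:-z, 1:] * q"
    by (metis poly_eq_0_iff_dvd dvdE)
  have "q \<noteq> 0"
    using Suc.hyps(2) p by auto
  then have deg: "degree p = Suc (degree q)"
    by (simp add: p degree_mult_eq del: mult_pCons_left)
  have lead: "lead_coeff p = lead_coeff q"
    by (simp only: p lead_coeff_mult) simp
  have "sublevel p \<rho> \<subseteq> {t\<in>{0..<2*pi}. cmod (cis t - z) < \<rho>} \<union> sublevel q \<rho>"
  proof
    fix t assume "t \<in> sublevel p \<rho>"
    then have t: "t \<in> {0..<2*pi}"
      and lt: "cmod (poly p (cis t)) < cmod (lead_coeff q) * \<rho> ^ degree q * \<rho>"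
      using lead by (auto simp: sublevel_def deg mult_ac)
    have "cmod (poly p (cis t)) = cmod (poly q (cis t)) * cmod (cis t - z)"
      by (simp add: p norm_mult[symmetric] algebra_simps)
    then have "\<not> (cmod (lead_coeff q) * \<rho> ^ degree q \<le> cmod (poly q (cis t)) \<and> \<rho> \<le> cmod (cis t - z))"
      using lt assms mult_mono[of "cmod (lead_coeff q) * \<rho> ^ degree q" "cmod (poly q (cis t))"
        \<rho> "cmod (cis t - z)"] by auto
    then show "t \<in> {t\<in>{0..<2*pi}. cmod (cis t - z) < \<rho>} \<union> sublevel q \<rho>"
      using t by (auto simp: sublevel_def)
  qed
  moreover have arc [measurable]: "{t\<in>{0..<2*pi}. cmod (cis t - z) < \<rho>} \<in> sets borel"
    by measurable
  ultimately have "emeasure lborel (sublevel p \<rho>)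
      \<le> emeasure lborel ({t\<in>{0..<2*pi}. cmod (cis t - z) < \<rho>} \<union> sublevel q \<rho>)"
    by (intro emeasure_mono) (simp_all add: arc del: atLeastLessThan_iff)
  also have "\<dots> \<le> emeasure lborel {t\<in>{0..<2*pi}. cmod (cis t - z) < \<rho>} + emeasure lborel (sublevel q \<rho>)"
    by (intro emeasure_subadditive) (simp_all add: arc del: atLeastLessThan_iff)
  also have "\<dots> \<le> ennreal (24 * \<rho>) + ennreal (24 * \<rho> * degree q)"
    using Suc.hyps(1)[of q] Suc.hyps(2) deg by (intro add_mono emeasure_arc_le assms) auto
  also have "\<dots> = ennreal (24 * \<rho> * degree p)"
    using assms by (simp add: deg algebra_simps flip: ennreal_plus)
  finally show ?case .
qed

text \<open>This is the measure-theoretic engine, used once for the angles \<open>\<alpha>\<close> and \<open>\<beta>\<close> and once for \<open>\<gamma>\<close>.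
  Members of length \<open>n\<close> get the radius \<open>\<rho> = 4\<^sup>-\<^sup>n / (k + 1)\<close>: the \<open>3\<^sup>n\<close> sublevel sets, each of measure
  \<open>O(n \<rho>)\<close>, then have total measure \<open>O(1 / (k + 1))\<close> over all \<open>n\<close>, and since degrees grow only linearly,
  \<open>\<rho>\<close> to the power of the degree is still \<open>D\<close> to the power \<open>-n\<^sup>2\<close>. Letting \<open>k\<close> grow shows that the points
  for which no constant \<open>D\<close> works form a null set. Here the points with some exact zero are dealt
  with at the same time as those with infinitely many small values.\<close>

lemma AE_poly_family_lower_bound:
  fixes f :: "'i \<Rightarrow> complex poly" and len :: "'i \<Rightarrow> nat"
  assumes fin: "\<And>n. finite {i\<in>J. len i = n}" and card: "\<And>n. card {i\<in>J. len i = n} \<le> 3 ^ n"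
    and pos: "\<And>i. i \<in> J \<Longrightarrow> 0 < len i"
    and deg: "\<And>i. i \<in> J \<Longrightarrow> degree (f i) \<le> 2 * len i"
    and lead: "\<And>i. i \<in> J \<Longrightarrow> (1 / K) ^ (len i)\<^sup>2 \<le> cmod (lead_coeff (f i))" and "1 \<le> K"
  shows "AE t in lborel. t \<in> {0..<2*pi} \<longrightarrow>
           (\<exists>D\<ge>1. \<forall>i\<in>J. (1 / D) ^ (len i)\<^sup>2 \<le> cmod (poly (f i) (cis t)))"
proof -
  define \<rho> :: "nat \<Rightarrow> nat \<Rightarrow> real" where "\<rho> k n = 1 / (real (Suc k) * 4 ^ n)" for k n
  have \<rho>: "0 < \<rho> k n" "\<rho> k n \<le> 1" for k n
  proof -
    have "1 * 1 \<le> real (Suc k) * 4 ^ n"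
      by (intro mult_mono) auto
    then show "0 < \<rho> k n" "\<rho> k n \<le> 1"
      by (auto simp: \<rho>_def divide_le_eq_1)
  qed
  define U where "U k = (\<Union>n. \<Union>i\<in>{i\<in>J. len i = n}. sublevel (f i) (\<rho> k n))" for k
  have U_sets [measurable]: "U k \<in> sets borel" for k
    unfolding U_def by (intro sets.countable_UN'' sets.finite_UN fin) auto
  define M where "M = (\<Sum>n. 48 * real n * (3/4) ^ n)"
  have summ: "summable (\<lambda>n. 48 * real n * (3/4) ^ n :: real)"
  proof -
    have "summable (\<lambda>n. 48 * (of_nat (Suc n) * (3/4) ^ n) :: real)"
      using geometric_deriv_sums[of "3/4 :: real"] by (intro summable_mult) (auto simp: sums_iff)
    then show ?thesis
      by (rule summable_comparison_test') (simp add: algebra_simps)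
  qed
  have U_le: "emeasure lborel (U k) \<le> ennreal (M / Suc k)" for k
  proof -
    have one: "emeasure lborel (\<Union>i\<in>{i\<in>J. len i = n}. sublevel (f i) (\<rho> k n))
        \<le> ennreal (48 * real n * (3/4) ^ n / Suc k)" for n
    proof -
      have "emeasure lborel (\<Union>i\<in>{i\<in>J. len i = n}. sublevel (f i) (\<rho> k n))
          \<le> (\<Sum>i\<in>{i\<in>J. len i = n}. emeasure lborel (sublevel (f i) (\<rho> k n)))"
        by (intro emeasure_subadditive_finite fin) auto
      also have "\<dots> \<le> (\<Sum>i\<in>{i\<in>J. len i = n}. ennreal (48 * real n * \<rho> k n))"
      proof (intro sum_mono order_trans[OF emeasure_sublevel_le] ennreal_leI)
        fix i assume "i \<in> {i\<in>J. len i = n}"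
        then have "real (degree (f i)) \<le> 2 * real n"
          using deg[of i] by auto
        then have "24 * \<rho> k n * real (degree (f i)) \<le> 24 * \<rho> k n * (2 * real n)"
          using \<rho>(1)[of k n] by (intro mult_left_mono) auto
        then show "24 * \<rho> k n * real (degree (f i)) \<le> 48 * real n * \<rho> k n"
          by (simp add: algebra_simps)
      qed (use \<rho>(1)[of k n] in simp)
      also have "\<dots> = ennreal (real (card {i\<in>J. len i = n}) * (48 * real n * \<rho> k n))"
        using \<rho>(1)[of k n] by (simp add: ennreal_mult' ennreal_of_nat_eq_real_of_nat)
      also have "\<dots> \<le> ennreal (3 ^ n * (48 * real n * \<rho> k n))"
        using \<rho>(1)[of k n] of_nat_mono[OF card[of n], where 'a=real]
        by (intro ennreal_leI mult_right_mono) simp_all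
      also have "3 ^ n * (48 * real n * \<rho> k n) = 48 * real n * (3/4) ^ n / Suc k"
        by (simp add: \<rho>_def power_divide mult_ac)
      finally show ?thesis .
    qed
    have "emeasure lborel (U k)
        \<le> (\<Sum>n. emeasure lborel (\<Union>i\<in>{i\<in>J. len i = n}. sublevel (f i) (\<rho> k n)))"
      unfolding U_def
      by (intro emeasure_subadditive_countably)
        (auto simp del: UN_iff intro!: sets.finite_UN fin)
    also have "\<dots> \<le> (\<Sum>n. ennreal (48 * real n * (3/4) ^ n / Suc k))"
      by (intro suminf_le one) auto
    also have "\<dots> = ennreal (\<Sum>n. 48 * real n * (3/4) ^ n / Suc k)"
      by (intro suminf_ennreal2 summable_divide summ) auto
    also have "(\<Sum>n. 48 * real n * (3/4) ^ n / Suc k) = M / Suc k"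
      unfolding M_def by (rule suminf_divide[OF summ])
    finally show ?thesis .
  qed
  have "emeasure lborel (\<Inter>k. U k) \<le> 0"
  proof (rule LIMSEQ_le_const)
    have "(\<lambda>k. M / real (Suc k)) \<longlonglongrightarrow> 0"
      by (rule LIMSEQ_Suc[OF lim_const_over_n])
    then show "(\<lambda>k. ennreal (M / real (Suc k))) \<longlonglongrightarrow> 0"
      using tendsto_ennrealI by fastforce
    show "\<exists>k0. \<forall>k\<ge>k0. emeasure lborel (\<Inter>k. U k) \<le> ennreal (M / real (Suc k))"
      by (intro exI allI impI order_trans[OF emeasure_mono U_le]) auto
  qed
  then have "(\<Inter>k. U k) \<in> null_sets lborel"
    by (intro null_setsI) auto
  then show ?thesis
  proof (rule AE_I')
    show "{t \<in> space lborel. \<not> (t \<in> {0..<2*pi} \<longrightarrow>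
        (\<exists>D\<ge>1. \<forall>i\<in>J. (1 / D) ^ (len i)\<^sup>2 \<le> cmod (poly (f i) (cis t))))} \<subseteq> (\<Inter>k. U k)"
    proof (intro subsetI InterI, clarsimp)
      fix t :: real and k :: nat
      assume t: "0 \<le> t" "t < 2 * pi"
        and no: "\<forall>D\<ge>1. \<exists>i\<in>J. \<not> (1 / D) ^ (len i)\<^sup>2 \<le> cmod (poly (f i) (cis t))"
      show "t \<in> U k"
      proof (rule ccontr)
        assume notU: "t \<notin> U k"
        \<comment> \<open>The factor \<open>K\<close> pays for the leading coefficient, and the square for degrees up to \<open>2n\<close>.\<close>
        define D where "D = K * (real (Suc k) * 4)\<^sup>2"
        have "1 * 1\<^sup>2 \<le> D"
          unfolding D_def using \<open>1 \<le> K\<close> by (intro mult_mono power_mono) auto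
        then obtain i where i: "i \<in> J" "cmod (poly (f i) (cis t)) < (1 / D) ^ (len i)\<^sup>2"
          using no[rule_format, of D] by auto
        let ?n = "len i"
        have "(1 / D) ^ ?n\<^sup>2 = (1 / K) ^ ?n\<^sup>2 * ((1 / (real (Suc k) * 4)) ^ ?n\<^sup>2)\<^sup>2"
          by (simp add: D_def power_divide power_mult_distrib power2_eq_square)
        also have "(1 / (real (Suc k) * 4)) ^ ?n\<^sup>2 \<le> \<rho> k ?n ^ ?n"
        proof -
          have "(1 / (real (Suc k) * 4)) ^ ?n \<le> \<rho> k ?n"
            using pos[OF \<open>i \<in> J\<close>] self_le_power[of "real (Suc k)" ?n]
            by (simp add: \<rho>_def power_divide power_mult_distrib frac_le mult_right_mono
                del: of_nat_Suc)
          then show ?thesis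
            by (simp add: power2_eq_square power_mult power_mono)
        qed
        then have "(1 / K) ^ ?n\<^sup>2 * ((1 / (real (Suc k) * 4)) ^ ?n\<^sup>2)\<^sup>2
            \<le> (1 / K) ^ ?n\<^sup>2 * (\<rho> k ?n ^ ?n)\<^sup>2"
          using \<open>1 \<le> K\<close> by (intro mult_left_mono power_mono) auto
        also have "(\<rho> k ?n ^ ?n)\<^sup>2 = \<rho> k ?n ^ (2 * ?n)"
          by (simp add: power_mult[symmetric] mult.commute)
        also have "(1 / K) ^ ?n\<^sup>2 * \<rho> k ?n ^ (2 * ?n)
            \<le> cmod (lead_coeff (f i)) * \<rho> k ?n ^ degree (f i)"
          using \<rho>[of k ?n] \<open>i \<in> J\<close> by (intro mult_mono lead power_decreasing deg) auto
        finally have "t \<in> sublevel (f i) (\<rho> k ?n)"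
          using i t by (simp add: sublevel_def)
        then show False
          using notU i by (auto simp: U_def)
      qed
    qed
  qed
qed

section \<open>Words as polynomials in the angle between the axes\<close>

lemma axis_rotation_0: "axis_rotation u 0 = mat 1"
  by (simp add: axis_rotation_nth vec_eq_iff forall_3 mat_def)

lemma funpow_axis_rotation:
  assumes "norm u = 1"
  shows "(((**) (axis_rotation u t)) ^^ n) (mat 1) = axis_rotation u (real n * t)"
  by (induction n) (simp_all add: axis_rotation_0 axis_rotation_add[OF assms] distrib_right)

lemma matrix_inv_axis_rotation:
  assumes "norm u = 1"
  shows "matrix_inv (axis_rotation u t) = axis_rotation u (- t)"
proof -
  have inv: "axis_rotation u t ** axis_rotation u (- t) = mat 1"
    "axis_rotation u (- t) ** axis_rotation u t = mat 1"
    using axis_rotation_add[OF assms, of t "- t"] axis_rotation_add[OF assms, of "- t" t]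
    by (simp_all add: axis_rotation_0)
  then have "axis_rotation u t ** matrix_inv (axis_rotation u t) = mat 1 \<and>
      matrix_inv (axis_rotation u t) ** axis_rotation u t = mat 1"
    unfolding matrix_inv_def by (intro someI_ex[of "\<lambda>X. axis_rotation u t ** X = mat 1 \<and> X ** axis_rotation u t = mat 1"]) blast
  then have "matrix_inv (axis_rotation u t) ** axis_rotation u t ** axis_rotation u (- t)
      = axis_rotation u (- t)"
    by simp
  then show ?thesis
    by (simp add: inv flip: matrix_mul_assoc)
qed

lemma matrix_powi_axis_rotation:
  assumes "norm u = 1"
  shows "matrix_powi (axis_rotation u t) k = axis_rotation u (of_int k * t)"
  by (auto simp: matrix_powi_def matrix_inv_axis_rotation[OF assms] funpow_axis_rotation[OF assms])

lemma W_Nil: "W [] \<alpha> \<beta> \<gamma> = mat 1"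
  by (simp add: W_def)

lemma W_Cons: "W ((s, r) # I) \<alpha> \<beta> \<gamma> =
    axis_rotation axis_A (of_int s * \<alpha>) ** axis_rotation (axis_B \<gamma>) (of_int r * \<beta>) ** W I \<alpha> \<beta> \<gamma>"
  by (simp add: W_def matrix_powi_axis_rotation norm_axis_A norm_axis_B)

text \<open>The vector \<open>(1, \<i>, 0)\<close>. It satisfies \<open>isotropic \<bullet> isotropic = 0\<close> for the bilinear dot product, and up
  to a scalar it is the limit of the direction \<open>axis_B \<gamma>\<close> as \<open>\<gamma>\<close> tends to \<open>-\<i> \<infinity>\<close>, that is, as
  \<open>e\<^sup>i\<^sup>\<gamma>\<close> becomes large. Because of this limit it describes leading coefficients in \<open>e\<^sup>i\<^sup>\<gamma>\<close>.\<close>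

definition isotropic :: "3 \<Rightarrow> complex" where
  "isotropic j = (if j = 1 then 1 else if j = 2 then \<i> else 0)"

lemma isotropic_simps [simp]: "isotropic 1 = 1" "isotropic 2 = \<i>" "isotropic 3 = 0"
  by (auto simp: isotropic_def)

text \<open>Multiplied by \<open>e\<^sup>i\<^sup>\<gamma>\<close>, each coordinate of the axis becomes a quadratic polynomial in \<open>e\<^sup>i\<^sup>\<gamma>\<close> whose top
  coefficients form half the isotropic vector. In Rodrigues' formula only the projection term
  \<open>(1 - cos t) u u\<^sup>T\<close> is quadratic in the axis \<open>u\<close>, so it alone contributes in degree 4, and the matrix
  of top coefficients has rank one. This rank-one form is what makes the leading coefficient of a
  whole word factor in \<open>poly_W\<close>.\<close>

lemma poly_rotation_axis_B:
  "\<exists>q :: 3 \<Rightarrow> 3 \<Rightarrow> complex poly. \<forall>k l. degree (q k l) \<le> 4 \<and>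
     coeff (q k l) 4 = of_real (1 - cos t) / 4 * isotropic k * isotropic l \<and>
     (\<forall>\<gamma>. poly (q k l) (cis \<gamma>) = cis \<gamma> ^ 2 * of_real (axis_rotation (axis_B \<gamma>) t $ k $ l))"
proof -
  define c s :: complex where "c = of_real (cos t)" and "s = of_real (sin t)"
  \<comment> \<open>\<open>u j\<close> is \<open>e\<^sup>i\<^sup>\<gamma>\<close> times the \<open>j\<close>-th coordinate of the axis, and \<open>\<epsilon>\<close> its cross product matrix.\<close>
  define u :: "3 \<Rightarrow> complex poly" where
    "u j = (if j = 1 then [:1/2, 0, 1/2:] else if j = 2 then [:-\<i>/2, 0, \<i>/2:] else 0)" for j
  define \<epsilon> :: "3 \<Rightarrow> 3 \<Rightarrow> complex poly" where
    "\<epsilon> k l = (if k = 1 \<and> l = 3 then u 2 else if k = 3 \<and> l = 1 then - u 2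
       else if k = 2 \<and> l = 3 then - u 1 else if k = 3 \<and> l = 2 then u 1 else 0)" for k l
  define q where "q k l = (if k = l then [:0, 0, c:] else 0) + [:1 - c:] * (u k * u l) + [:0, s:] * \<epsilon> k l" for k l
  have u_eval: "poly (u j) (cis \<gamma>) = cis \<gamma> * of_real (axis_B \<gamma> $ j)" for j \<gamma>
    using exhaust_3[of j]
    by (auto simp: u_def axis_B_def complex_eq_iff power2_eq_square[symmetric] Re_power2 Im_power2
        cos_squared_eq field_simps)
  have deg_u: "degree (u j) \<le> 2" for j
    by (auto simp: u_def)
  have deg_\<epsilon>: "degree (\<epsilon> k l) \<le> 2" for k l
    by (auto simp: \<epsilon>_def deg_u)
  have deg: "degree (q k l) \<le> 4" for k l
    unfolding q_def
    by (intro degree_add_le order_trans[OF degree_mult_le] order_trans[OF add_mono[OF _ deg_\<epsilon>, of _ 1]]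
        order_trans[OF add_mono[OF _ order_trans[OF degree_mult_le add_mono[OF deg_u deg_u]], of _ 0]]) auto
  have coeff: "\<forall>k l. coeff (q k l) 4 = of_real (1 - cos t) / 4 * isotropic k * isotropic l"
    by (simp add: forall_3 q_def u_def \<epsilon>_def eval_nat_numeral coeff_pCons c_def field_simps)

  have eval: "\<forall>k l. poly (q k l) (cis \<gamma>) = cis \<gamma> ^ 2 * of_real (axis_rotation (axis_B \<gamma>) t $ k $ l)" for \<gamma>
    by (simp add: forall_3 q_def \<epsilon>_def u_eval axis_rotation_nth axis_B_def c_def s_def algebra_simps
        power2_eq_square)
  show ?thesis
    using deg coeff eval by blast
qed

lemma coeff_mult_at_bounds:
  assumes "degree p \<le> m" "degree q \<le> n"
  shows "coeff (p * q) (m + n) = coeff p m * coeff q n"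
proof -
  have "coeff (p * q) (m + n) = (\<Sum>i\<le>m + n. if i = m then coeff p m * coeff q n else 0)"
    unfolding coeff_mult
  proof (intro sum.cong refl)
    fix i
    have "i > m \<or> i = m \<or> m + n - i > n \<or> m + n < i"
      by linarith
    then show "coeff p i * coeff q (m + n - i) = (if i = m then coeff p m * coeff q n else 0)" if "i \<in> {..m + n}"
      using assms that by (auto simp: coeff_eq_0)
  qed
  then show ?thesis
    by simp
qed

text \<open>The first column of a word, multiplied by \<open>e\<^sup>2\<^sup>i\<^sup>m\<^sup>\<gamma>\<close>, is a vector of polynomials in \<open>e\<^sup>i\<^sup>\<gamma>\<close>. Its vector of
  top coefficients, paired with the isotropic vector \<open>w\<close>, is multiplicative in the syllables: the
  syllable \<open>A\<^sup>s B\<^sup>r\<close> has the top coefficient matrix \<open>(1 - cos (r \<beta>))/4 \<cdot> A\<^sup>s w w\<^sup>T\<close>, and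
  \<open>w\<^sup>T A\<^sup>s w = 1 - cos (s \<alpha>)\<close>. Pairing with \<open>w\<close> instead of reading off one entry keeps the first syllable
  from being an exception; the empty word starts the induction with \<open>w\<^sub>1 = 1\<close>.\<close>

lemma poly_W:
  "\<exists>p :: 3 \<Rightarrow> complex poly.
     (\<forall>k. degree (p k) \<le> 4 * length I) \<and>
     (\<forall>k \<gamma>. poly (p k) (cis \<gamma>) = cis \<gamma> ^ (2 * length I) * of_real (W I \<alpha> \<beta> \<gamma> $ k $ 1)) \<and>
     (\<Sum>k\<in>UNIV. isotropic k * coeff (p k) (4 * length I)) =
       of_real (\<Prod>(s, r)\<leftarrow>I. (1 - cos (of_int s * \<alpha>)) * (1 - cos (of_int r * \<beta>)) / 4)"
proof (induction I)
  case Nil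
  then show ?case
    by (intro exI[of _ "\<lambda>k. if k = 1 then 1 else 0"]) (auto simp: W_Nil mat_def sum_3)
next
  case (Cons sr I)
  obtain s r where sr: "sr = (s, r)"
    by (cases sr)
  obtain p :: "3 \<Rightarrow> complex poly" where p: "(\<forall>k. degree (p k) \<le> 4 * length I) \<and>
     (\<forall>k \<gamma>. poly (p k) (cis \<gamma>) = cis \<gamma> ^ (2 * length I) * of_real (W I \<alpha> \<beta> \<gamma> $ k $ 1)) \<and>
     (\<Sum>k\<in>UNIV. isotropic k * coeff (p k) (4 * length I)) =
       of_real (\<Prod>(s, r)\<leftarrow>I. (1 - cos (of_int s * \<alpha>)) * (1 - cos (of_int r * \<beta>)) / 4)"
    using Cons.IH by (rule exE)
  note deg_p = p[THEN conjunct1, rule_format]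
    and eval_p = p[THEN conjunct2, THEN conjunct1, rule_format]
    and lead_p = p[THEN conjunct2, THEN conjunct2]
  obtain q :: "3 \<Rightarrow> 3 \<Rightarrow> complex poly" where q: "\<forall>k l. degree (q k l) \<le> 4 \<and>
     coeff (q k l) 4 = of_real (1 - cos (of_int r * \<beta>)) / 4 * isotropic k * isotropic l \<and>
     (\<forall>\<gamma>. poly (q k l) (cis \<gamma>)
        = cis \<gamma> ^ 2 * of_real (axis_rotation (axis_B \<gamma>) (of_int r * \<beta>) $ k $ l))"
    using poly_rotation_axis_B by (rule exE)
  have deg_q: "degree (q k l) \<le> 4"
    and coeff_q: "coeff (q k l) 4 = of_real (1 - cos (of_int r * \<beta>)) / 4 * isotropic k * isotropic l"
    and eval_q: "poly (q k l) (cis \<gamma>) = cis \<gamma> ^ 2 * of_real (axis_rotation (axis_B \<gamma>) (of_int r * \<beta>) $ k $ l)"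
    for k l \<gamma>
    using q by auto
  define A where "A = axis_rotation axis_A (of_int s * \<alpha>)"
  define p' where "p' k = (\<Sum>l\<in>UNIV. \<Sum>j\<in>UNIV. smult (of_real (A $ k $ l)) (q l j * p j))" for k
  have "degree (p' k) \<le> 4 * length (sr # I)" for k
    unfolding p'_def
    by (intro degree_sum_le finite order_trans[OF degree_smult_le] order_trans[OF degree_mult_le]
        order_trans[OF add_mono[OF deg_q deg_p]]) auto
  moreover have "poly (p' k) (cis \<gamma>) = cis \<gamma> ^ (2 * length (sr # I)) * of_real (W (sr # I) \<alpha> \<beta> \<gamma> $ k $ 1)" for k \<gamma>
  proof -
    let ?B = "axis_rotation (axis_B \<gamma>) (of_int r * \<beta>)"
    have W: "W (sr # I) \<alpha> \<beta> \<gamma> $ k $ 1 = (\<Sum>l\<in>UNIV. \<Sum>j\<in>UNIV. A $ k $ l * (?B $ l $ j * W I \<alpha> \<beta> \<gamma> $ j $ 1))"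
      unfolding sr W_Cons A_def[symmetric] matrix_mul_assoc[symmetric]
      by (simp add: matrix_matrix_mult_def sum_distrib_left)
    have "cis \<gamma> ^ (2 * length (sr # I)) = cis \<gamma> ^ 2 * cis \<gamma> ^ (2 * length I)"
      by (simp flip: power_add)
    then show ?thesis
      unfolding W p'_def poly_sum poly_smult poly_mult eval_q eval_p of_real_sum of_real_mult
      by (simp only: sum_distrib_left mult_ac)
  qed
  moreover have "(\<Sum>k\<in>UNIV. isotropic k * coeff (p' k) (4 * length (sr # I))) =
      of_real (1 - cos (of_int s * \<alpha>)) * (of_real (1 - cos (of_int r * \<beta>)) / 4) *
        (\<Sum>j\<in>UNIV. isotropic j * coeff (p j) (4 * length I))"
  proof -
    define S where "S = (\<Sum>j\<in>UNIV. isotropic j * coeff (p j) (4 * length I))"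
    define d :: complex where "d = of_real (1 - cos (of_int r * \<beta>)) / 4"
    have "coeff (p' k) (4 * length (sr # I)) =
        (\<Sum>l\<in>UNIV. \<Sum>j\<in>UNIV. of_real (A $ k $ l) * (coeff (q l j) 4 * coeff (p j) (4 * length I)))" for k
      using coeff_mult_at_bounds[OF deg_q deg_p] by (simp add: p'_def coeff_sum)
    moreover have "(\<Sum>l\<in>UNIV. \<Sum>j\<in>UNIV. of_real (A $ k $ l) * (coeff (q l j) 4 * coeff (p j) (4 * length I)))
        = (\<Sum>l\<in>UNIV. of_real (A $ k $ l) * isotropic l) * d * S" for k
      unfolding coeff_q d_def[symmetric] sum_distrib_right
      by (intro sum.cong refl) (simp only: S_def sum_distrib_left mult_ac)
    ultimately have "coeff (p' k) (4 * length (sr # I)) = (\<Sum>l\<in>UNIV. of_real (A $ k $ l) * isotropic l) * d * S" for k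
      by simp
    then have "(\<Sum>k\<in>UNIV. isotropic k * coeff (p' k) (4 * length (sr # I))) =
        (\<Sum>k\<in>UNIV. isotropic k * (\<Sum>l\<in>UNIV. of_real (A $ k $ l) * isotropic l)) * d * S"
      by (simp only: sum_distrib_right mult.assoc)
    also have "(\<Sum>k\<in>UNIV. isotropic k * (\<Sum>l\<in>UNIV. of_real (A $ k $ l) * isotropic l)) = of_real (1 - cos (of_int s * \<alpha>))"
      by (simp add: A_def rotation_axis_A sum_3 algebra_simps)
    finally show ?thesis
      unfolding d_def S_def .
  qed
  ultimately show ?case
    by (intro exI[of _ p']) (simp add: lead_p sr)
qed

text \<open>The pairing of the first column of \<open>M\<close> with the isotropic vector, as a complex number.\<close>

abbreviation test_entry :: "real^3^3 \<Rightarrow> complex" where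
  "test_entry M \<equiv> Complex (M $ 1 $ 1) (M $ 2 $ 1)"

text \<open>Subtracting a constant matrix changes only the coefficient in the middle degree \<open>2m\<close> of a polynomial
  of degree \<open>4m\<close>, so for a nonempty word the leading coefficient is the same for every \<open>C\<close>.\<close>

lemma poly_W_minus:
  assumes "I \<noteq> []"
  obtains p where "degree p \<le> 4 * length I"
    "coeff p (4 * length I) =
       of_real (\<Prod>(s, r)\<leftarrow>I. (1 - cos (of_int s * \<alpha>)) * (1 - cos (of_int r * \<beta>)) / 4)"
    "\<And>\<gamma>. cmod (poly p (cis \<gamma>)) = cmod (test_entry (W I \<alpha> \<beta> \<gamma> - C))"
proof -
  let ?m = "length I"
  obtain p :: "3 \<Rightarrow> complex poly" where deg: "\<And>k. degree (p k) \<le> 4 * ?m"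
    and eval: "\<And>k \<gamma>. poly (p k) (cis \<gamma>) = cis \<gamma> ^ (2 * ?m) * of_real (W I \<alpha> \<beta> \<gamma> $ k $ 1)"
    and lead: "(\<Sum>k\<in>UNIV. isotropic k * coeff (p k) (4 * ?m)) =
       of_real (\<Prod>(s, r)\<leftarrow>I. (1 - cos (of_int s * \<alpha>)) * (1 - cos (of_int r * \<beta>)) / 4)"
    using poly_W[of I \<alpha> \<beta>] by blast
  define q where "q = p 1 + smult \<i> (p 2) - monom (Complex (C $ 1 $ 1) (C $ 2 $ 1)) (2 * ?m)"
  show thesis
  proof
    show "degree q \<le> 4 * ?m"
      unfolding q_def
      by (intro degree_diff_le degree_add_le order_trans[OF degree_smult_le] deg
          order_trans[OF degree_monom_le]) auto
    show "coeff q (4 * ?m) =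
       of_real (\<Prod>(s, r)\<leftarrow>I. (1 - cos (of_int s * \<alpha>)) * (1 - cos (of_int r * \<beta>)) / 4)"
      using lead assms by (simp add: q_def sum_3)
    fix \<gamma>
    have "poly q (cis \<gamma>) = cis \<gamma> ^ (2 * ?m) *
        test_entry (W I \<alpha> \<beta> \<gamma> - C)"
      by (simp add: q_def poly_monom eval Complex_eq algebra_simps)
    then show "cmod (poly q (cis \<gamma>)) = cmod (test_entry (W I \<alpha> \<beta> \<gamma> - C))"
      by (simp add: norm_mult norm_power)
  qed
qed

section \<open>The number of words of a given length\<close>

text \<open>Finite sequences of nonzero integers, counted by the sum of absolute values: compositions of \<open>n\<close>
  with signed parts. Multi-indices embed into them by forgetting the pairing.\<close>

definition compositions :: "nat \<Rightarrow> int list set" where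
  "compositions n = {xs. 0 \<notin> set xs \<and> (\<Sum>x\<leftarrow>xs. nat \<bar>x\<bar>) = n}"

fun enlarge_hd :: "int list \<Rightarrow> int list" where
  "enlarge_hd [] = []"
| "enlarge_hd (x # xs) = (x + sgn x) # xs"

text \<open>Moving the first part one step towards zero, or deleting it if it is \<open>\<plusminus>1\<close>, reduces the sum by one,
  and there are three ways to undo this. Hence the growth rate \<open>3\<close> below.\<close>

lemma compositions_Suc:
  "compositions (Suc n) \<subseteq>
     enlarge_hd ` compositions n \<union> (Cons 1 ` compositions n \<union> Cons (- 1) ` compositions n)"
proof
  fix xs assume "xs \<in> compositions (Suc n)"
  then obtain y ys where xs: "xs = y # ys" "y \<noteq> 0" "0 \<notin> set ys"
      "nat \<bar>y\<bar> + (\<Sum>x\<leftarrow>ys. nat \<bar>x\<bar>) = Suc n"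
    by (cases xs) (auto simp: compositions_def)
  consider "\<bar>y\<bar> \<ge> 2" | "y = 1" | "y = - 1"
    using \<open>y \<noteq> 0\<close> by linarith
  then show "xs \<in> enlarge_hd ` compositions n \<union> (Cons 1 ` compositions n \<union> Cons (- 1) ` compositions n)"
  proof cases
    case 1
    then have "(y - sgn y) # ys \<in> compositions n" "enlarge_hd ((y - sgn y) # ys) = xs"
      using xs by (auto simp: compositions_def sgn_if)
    then show ?thesis by blast
  qed (use xs in \<open>auto simp: compositions_def\<close>)
qed

lemma card_compositions: "finite (compositions n) \<and> card (compositions n) \<le> 3 ^ n"
proof (induction n)
  case 0
  have "compositions 0 = {[]}"
  proof (intro equalityI subsetI)
    fix xs assume "xs \<in> compositions 0"
    then show "xs \<in> {[]}"
      by (cases xs) (auto simp: compositions_def)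
  qed (auto simp: compositions_def)
  then show ?case by simp
next
  case (Suc n)
  let ?R = "enlarge_hd ` compositions n \<union> (Cons 1 ` compositions n \<union> Cons (- 1) ` compositions n)"
  have fin: "finite ?R"
    using Suc by simp
  have "card ?R \<le> card (compositions n) + (card (compositions n) + card (compositions n))"
    using Suc by (intro order_trans[OF card_Un_le] add_mono card_image_le) auto
  then show ?case
    using Suc finite_subset[OF compositions_Suc fin] card_mono[OF fin compositions_Suc] by auto
qed

definition flatten :: "(int \<times> int) list \<Rightarrow> int list" where
  "flatten I = concat (map (\<lambda>(s, r). [s, r]) I)"

lemma inj_flatten: "inj flatten"
proof (rule injI)
  show "flatten I = flatten J \<Longrightarrow> I = J" for I J
  proof (induction I arbitrary: J)
    case Nil
    then show ?case by (cases J) (auto simp: flatten_def)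
  next
    case (Cons a I)
    then show ?case by (cases J) (auto simp: flatten_def split: prod.splits)
  qed
qed

lemma flatten_in_compositions:
  assumes "I \<in> multi_indices"
  shows "flatten I \<in> compositions (multi_length I)"
proof -
  have "(\<Sum>x\<leftarrow>flatten I. nat \<bar>x\<bar>) = multi_length I"
    by (induction I) (auto simp: flatten_def multi_length_def)
  then show ?thesis
    using assms by (auto simp: compositions_def multi_indices_def flatten_def)
qed

lemma card_multi_indices:
  "finite {I\<in>multi_indices. multi_length I = n}"
  "card {I\<in>multi_indices. multi_length I = n} \<le> 3 ^ n"
proof -
  have sub: "flatten ` {I\<in>multi_indices. multi_length I = n} \<subseteq> compositions n"
    using flatten_in_compositions by auto
  have inj: "inj_on flatten A" for A
    using inj_flatten by (rule inj_on_subset) simp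
  show "finite {I\<in>multi_indices. multi_length I = n}"
    using finite_subset[OF sub] card_compositions[of n] inj by (blast intro: finite_imageD)
  show "card {I\<in>multi_indices. multi_length I = n} \<le> 3 ^ n"
    using card_inj_on_le[OF inj sub] card_compositions[of n] by auto
qed

lemma length_le_multi_length:
  assumes "\<forall>(s, r)\<in>set I. s \<noteq> 0 \<and> r \<noteq> 0"
  shows "2 * length I \<le> multi_length I"
  using assms by (induction I) (auto simp: multi_length_def)

section \<open>Lower bounds for almost every angle\<close>

text \<open>The numbers \<open>2 (1 - cos (k t))\<close> are the squares \<open>\<bar>z\<^sup>k - 1\<bar>\<^sup>2\<close> at \<open>z = e\<^sup>i\<^sup>t\<close>, and the polynomials
  \<open>z\<^sup>k - 1\<close> are a family with one monic member of each degree.\<close>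

lemma AE_one_minus_cos_lower_bound:
  "AE t in lborel. t \<in> {0..<2*pi} \<longrightarrow>
     (\<exists>D\<ge>1. \<forall>k::int. k \<noteq> 0 \<longrightarrow> (1 / D) ^ (nat \<bar>k\<bar>)\<^sup>2 \<le> 1 - cos (of_int k * t))"
proof -
  have deg: "degree (monom 1 k - 1 :: complex poly) = k" if "0 < k" for k
    using that by (intro antisym[OF _ le_degree] degree_diff_le order_trans[OF degree_monom_le]) auto
  have "AE t in lborel. t \<in> {0..<2*pi} \<longrightarrow> (\<exists>D\<ge>1. \<forall>k\<in>{0<..}. 
      (1 / D) ^ k\<^sup>2 \<le> cmod (poly (monom 1 k - 1) (cis t)))"
  proof (rule AE_poly_family_lower_bound[where K = 1])
    fix n :: nat
    have "{i \<in> {0<..}. i = n} \<subseteq> {n}"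
      by auto
    then show "finite {i \<in> {0<..}. i = n}" "card {i \<in> {0<..}. i = n} \<le> 3 ^ n"
      using finite_subset card_mono[of "{n}" "{i \<in> {0<..}. i = n}"] order_trans[of _ 1 "3 ^ n :: nat"] by auto
  qed (auto simp: deg)
  then show ?thesis
  proof (rule eventually_mono, intro impI)
    fix t assume "t \<in> {0..<2*pi} \<longrightarrow> (\<exists>D\<ge>1. \<forall>k\<in>{0<..}. 
      (1 / D) ^ k\<^sup>2 \<le> cmod (poly (monom 1 k - 1) (cis t)))" "t \<in> {0..<2*pi}"
    then obtain D where D: "D \<ge> 1" 
      "\<And>k. 0 < k \<Longrightarrow> (1 / D) ^ k\<^sup>2 \<le> cmod (poly (monom 1 k - 1) (cis t))"
      by auto
    have "(1 / (2 * D\<^sup>2)) ^ (nat \<bar>k\<bar>)\<^sup>2 \<le> 1 - cos (of_int k * t)" if "k \<noteq> 0" for k :: int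
    proof -
      let ?n = "nat \<bar>k\<bar>"
      have "0 < ?n"
        using that by simp
      have "(1 / 2 :: real) ^ ?n\<^sup>2 \<le> (1 / 2) ^ 1"
        using \<open>0 < ?n\<close> by (intro power_decreasing) (auto simp: Suc_le_eq)
      then have "(1 / (2 * D\<^sup>2)) ^ ?n\<^sup>2 \<le> ((1 / D) ^ ?n\<^sup>2)\<^sup>2 / 2"
        using mult_right_mono[of "(1/2) ^ ?n\<^sup>2" "1/2" "((1 / D) ^ ?n\<^sup>2)\<^sup>2"]
        by (simp add: power_mult_distrib power_divide flip: power_mult mult.commute[of 2])
      also have "\<dots> \<le> (cmod (poly (monom 1 ?n - 1) (cis t)))\<^sup>2 / 2"
        using D \<open>0 < ?n\<close> by (intro divide_right_mono power_mono) auto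
      also have "poly (monom 1 ?n - 1) (cis t) = cis (real ?n * t) - cis 0"
        by (simp only: poly_diff poly_monom poly_1 Complex.DeMoivre cis_zero mult_1_left)
      also have "(cmod (cis (real ?n * t) - cis 0))\<^sup>2 / 2 = 1 - cos (real ?n * t)"
        by (simp add: cmod_power2 power2_diff sin_squared_eq)
      also have "cos (real ?n * t) = cos (of_int k * t)"
        by (simp add: abs_if)
      finally show ?thesis .
    qed
    moreover have "1 \<le> D\<^sup>2"
      using \<open>1 \<le> D\<close> by simp
    then have "1 \<le> 2 * D\<^sup>2"
      by linarith
    ultimately show "\<exists>D\<ge>1. \<forall>k::int. k \<noteq> 0 \<longrightarrow> (1 / D) ^ (nat \<bar>k\<bar>)\<^sup>2 \<le> 1 - cos (of_int k * t)"
      by blast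
  qed
qed

text \<open>Under multiplication the bounds combine to an exponent that is the sum of the squares of the
  exponents in the word, and this is at most the square of the sum of their absolute values.\<close>

lemma leading_coeff_lower_bound:
  fixes D \<alpha> \<beta> :: real
  assumes D: "1 \<le> D"
    and \<alpha>: "\<And>k::int. k \<noteq> 0 \<Longrightarrow> (1 / D) ^ (nat \<bar>k\<bar>)\<^sup>2 \<le> 1 - cos (of_int k * \<alpha>)"
    and \<beta>: "\<And>k::int. k \<noteq> 0 \<Longrightarrow> (1 / D) ^ (nat \<bar>k\<bar>)\<^sup>2 \<le> 1 - cos (of_int k * \<beta>)"
    and I: "\<forall>(s, r)\<in>set I. s \<noteq> 0 \<and> r \<noteq> 0"
  shows "(1 / (4 * D)) ^ (multi_length I)\<^sup>2
           \<le> (\<Prod>(s, r)\<leftarrow>I. (1 - cos (of_int s * \<alpha>)) * (1 - cos (of_int r * \<beta>)) / 4)"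
  using I
proof (induction I)
  case Nil
  then show ?case by (simp add: multi_length_def)
next
  case (Cons sr I)
  obtain s r where sr: "sr = (s, r)" "s \<noteq> 0" "r \<noteq> 0"
    using Cons.prems by (cases sr) auto
  define a b n where "a = nat \<bar>s\<bar>" and "b = nat \<bar>r\<bar>" and "n = multi_length I"
  define x where "x = 1 / (4 * D)"
  have x: "0 \<le> x" "x \<le> 1" "x \<le> 1 / D" "x \<le> 1 / 4 * (1 / D)"
    using D by (auto simp: x_def field_simps)
  have "0 < b"
    using sr by (simp add: b_def)
  have "x ^ (multi_length (sr # I))\<^sup>2 \<le> x ^ (a\<^sup>2 + b\<^sup>2 + n\<^sup>2)"
    using x by (intro power_decreasing)
      (auto simp: sr multi_length_def a_def b_def n_def power2_eq_square algebra_simps)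
  also have "\<dots> = x ^ a\<^sup>2 * x ^ b\<^sup>2 * x ^ n\<^sup>2"
    by (simp add: power_add)
  also have "\<dots> \<le> (1 / D) ^ a\<^sup>2 * (1 / 4 * (1 / D) ^ b\<^sup>2) * x ^ n\<^sup>2"
  proof (intro mult_mono)
    have "(1 / 4 :: real) ^ b\<^sup>2 \<le> (1 / 4) ^ 1"
      using \<open>0 < b\<close> by (intro power_decreasing) (auto simp: Suc_le_eq)
    then have "(1 / 4) ^ b\<^sup>2 * (1 / D) ^ b\<^sup>2 \<le> 1 / 4 * (1 / D) ^ b\<^sup>2"
      using D by (intro mult_right_mono) auto
    then show "x ^ b\<^sup>2 \<le> 1 / 4 * (1 / D) ^ b\<^sup>2"
      by (simp add: x_def power_mult_distrib power_divide)
  qed (use x D in \<open>auto intro!: power_mono\<close>)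
  also have "\<dots> \<le> (1 - cos (of_int s * \<alpha>)) * (1 / 4 * (1 - cos (of_int r * \<beta>))) *
      (\<Prod>(s, r)\<leftarrow>I. (1 - cos (of_int s * \<alpha>)) * (1 - cos (of_int r * \<beta>)) / 4)"
  proof (intro mult_mono)
    show "(1 / D) ^ a\<^sup>2 \<le> 1 - cos (of_int s * \<alpha>)" "(1 / D) ^ b\<^sup>2 \<le> 1 - cos (of_int r * \<beta>)"
      unfolding a_def b_def using sr by (blast intro: \<alpha> \<beta>)+
    show "x ^ n\<^sup>2 \<le> (\<Prod>(s, r)\<leftarrow>I. (1 - cos (of_int s * \<alpha>)) * (1 - cos (of_int r * \<beta>)) / 4)"
      unfolding x_def n_def by (rule Cons.IH) (use Cons.prems in simp)
  qed (use D x in simp_all)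
  finally show ?case
    by (simp add: sr x_def)
qed

lemma AE_test_entry_lower_bound:
  assumes D: "1 \<le> D"
    and \<alpha>: "\<And>k::int. k \<noteq> 0 \<Longrightarrow> (1 / D) ^ (nat \<bar>k\<bar>)\<^sup>2 \<le> 1 - cos (of_int k * \<alpha>)"
    and \<beta>: "\<And>k::int. k \<noteq> 0 \<Longrightarrow> (1 / D) ^ (nat \<bar>k\<bar>)\<^sup>2 \<le> 1 - cos (of_int k * \<beta>)"
  shows "AE \<gamma> in lborel. \<gamma> \<in> {0..<2*pi} \<longrightarrow>
           (\<exists>D\<ge>1. \<forall>I\<in>multi_indices.
             (1 / D) ^ (multi_length I)\<^sup>2 \<le> cmod (test_entry (W I \<alpha> \<beta> \<gamma> - C)))"
proof -
  define c where "c I = (\<Prod>(s, r)\<leftarrow>I. (1 - cos (of_int s * \<alpha>)) * (1 - cos (of_int r * \<beta>)) / 4)" for I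
  have c: "0 < (1 / (4 * D)) ^ (multi_length I)\<^sup>2" "(1 / (4 * D)) ^ (multi_length I)\<^sup>2 \<le> c I" 
    if "I \<in> multi_indices" for I
    using leading_coeff_lower_bound[OF assms, of I] that D
    by (auto simp: multi_indices_def c_def)
  have "\<forall>I\<in>multi_indices. \<exists>p. degree p \<le> 4 * length I \<and> coeff p (4 * length I) = of_real (c I) \<and>
      (\<forall>\<gamma>. cmod (poly p (cis \<gamma>)) = cmod (test_entry (W I \<alpha> \<beta> \<gamma> - C)))"
  proof
    fix I assume "I \<in> multi_indices"
    then have "I \<noteq> []"
      by (simp add: multi_indices_def)
    from poly_W_minus[OF this, of \<alpha> \<beta> C]
    show "\<exists>p. degree p \<le> 4 * length I \<and> coeff p (4 * length I) = of_real (c I) \<and>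
        (\<forall>\<gamma>. cmod (poly p (cis \<gamma>)) = cmod (test_entry (W I \<alpha> \<beta> \<gamma> - C)))"
      unfolding c_def by metis
  qed
  then obtain f where f: "\<And>I. I \<in> multi_indices \<Longrightarrow> degree (f I) \<le> 4 * length I"
      "\<And>I. I \<in> multi_indices \<Longrightarrow> coeff (f I) (4 * length I) = of_real (c I)"
      "\<And>I \<gamma>. I \<in> multi_indices \<Longrightarrow> cmod (poly (f I) (cis \<gamma>)) = cmod (test_entry (W I \<alpha> \<beta> \<gamma> - C))"
    by metis
  have deg: "degree (f I) = 4 * length I" if "I \<in> multi_indices" for I
    using f(1,2)[OF that] c[OF that] by (intro antisym le_degree) auto
  have len: "2 * length I \<le> multi_length I" "0 < length I" if "I \<in> multi_indices" for I
    using length_le_multi_length[of I] that by (auto simp: multi_indices_def)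
  have "AE \<gamma> in lborel. \<gamma> \<in> {0..<2*pi} \<longrightarrow>
      (\<exists>D\<ge>1. \<forall>I\<in>multi_indices. (1 / D) ^ (multi_length I)\<^sup>2 \<le> cmod (poly (f I) (cis \<gamma>)))"
  proof (rule AE_poly_family_lower_bound[where K = "4 * D"])
    fix I assume I: "I \<in> multi_indices"
    show "0 < multi_length I" "degree (f I) \<le> 2 * multi_length I"
      unfolding deg[OF I] using len[OF I] by linarith+
    show "(1 / (4 * D)) ^ (multi_length I)\<^sup>2 \<le> cmod (lead_coeff (f I))"
      using c[OF I] by (simp add: deg[OF I] f(2)[OF I])
  qed (use D card_multi_indices in auto)
  then show ?thesis
    by (simp add: f(3))
qed

section \<open>From single angles to the torus\<close>

text \<open>Fubini's theorem for null sets.\<close>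

lemma AE_lborel_triple:
  fixes P :: "real \<times> real \<times> real \<Rightarrow> bool"
  assumes meas: "{x. P x} \<in> sets borel"
    and AE: "AE a in lborel. AE b in lborel. AE c in lborel. P (a, b, c)"
  shows "AE x in lborel. P x"
proof -
  have slice: "AE y in lborel. P (a, y)" if "AE b in lborel. AE c in lborel. P (a, b, c)" for a
  proof -
    have "{y. P (a, y)} = Pair a -` {x. P x}"
      by auto
    also have "\<dots> \<in> sets borel"
      using meas by (intro measurable_sets_borel[of _ borel] borel_measurable_continuous_onI continuous_intros)
    finally have "{y \<in> space (lborel \<Otimes>\<^sub>M lborel). P (a, y)} \<in> sets (lborel \<Otimes>\<^sub>M lborel)"
      unfolding lborel_prod by simp
    then have "AE y in lborel \<Otimes>\<^sub>M lborel. P (a, y)"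
      using that by (rule lborel_pair.AE_pair_measure)
    then show ?thesis
      unfolding lborel_prod .
  qed
  have "AE a in lborel. AE y in lborel. P (a, y)"
    using AE by (rule eventually_mono) (rule slice)
  moreover have "{x \<in> space (lborel \<Otimes>\<^sub>M lborel). P x} \<in> sets (lborel \<Otimes>\<^sub>M lborel)"
    unfolding lborel_prod using meas by simp
  ultimately have "AE x in lborel \<Otimes>\<^sub>M lborel. P x"
    by (intro lborel_pair.AE_pair_measure)
  then show ?thesis
    unfolding lborel_prod .
qed

lemma continuous_on_axis_rotation_nth:
  fixes u :: "'a::t2_space \<Rightarrow> real^3"
  assumes "\<And>i. continuous_on S (\<lambda>x. u x $ i)" "continuous_on S t"
  shows "continuous_on S (\<lambda>x. axis_rotation (u x) (t x) $ k $ l)"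
  using exhaust_3[of k] exhaust_3[of l]
  by (elim disjE) (auto simp: axis_rotation_nth intro!: continuous_intros assms)

lemma continuous_on_W_nth:
  "continuous_on UNIV (\<lambda>x. W I (fst x) (fst (snd x)) (snd (snd x)) $ k $ l)"
proof (induction I arbitrary: k l)
  case (Cons sr I)
  obtain s r where sr: "sr = (s, r)"
    by (cases sr)
  have "continuous_on UNIV (\<lambda>x::real \<times> real \<times> real. axis_B (snd (snd x)) $ i)" for i
    using exhaust_3[of i] by (elim disjE) (auto simp: axis_B_def intro!: continuous_intros)
  then have "continuous_on UNIV (\<lambda>x::real \<times> real \<times> real.
      axis_rotation (axis_B (snd (snd x))) (of_int r * fst (snd x)) $ i $ j)" for i j
    by (rule continuous_on_axis_rotation_nth) (intro continuous_intros)
  moreover have "continuous_on UNIV (\<lambda>x::real \<times> real \<times> real.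
      axis_rotation axis_A (of_int s * fst x) $ i $ j)" for i j
    by (intro continuous_on_axis_rotation_nth continuous_intros)
  ultimately show ?case
    unfolding sr W_Cons matrix_matrix_mult_def
    by (simp, intro continuous_on_sum continuous_on_mult Cons.IH) auto
qed (simp add: W_Nil)

text \<open>All norms on a finite-dimensional space are equivalent: a norm is convex, hence continuous, hence
  bounded away from zero on the unit sphere.\<close>

lemma matrix_norm_lower_bound:
  assumes "matrix_norm N"
  obtains c where "0 < c" "\<And>M. c * cmod (test_entry M) \<le> N M"
proof -
  have nonneg: "0 \<le> N M" and zero: "N M = 0 \<longleftrightarrow> M = 0" and scale: "N (a *\<^sub>R M) = \<bar>a\<bar> * N M"
    and triangle: "N (L + M) \<le> N L + N M" for a L M
    using assms by (auto simp: matrix_norm_def)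
  have "convex_on UNIV N"
  proof (rule convex_onI)
    fix t :: real and x y assume "0 < t" "t < 1"
    then show "N ((1 - t) *\<^sub>R x + t *\<^sub>R y) \<le> (1 - t) * N x + t * N y"
      using triangle[of "(1 - t) *\<^sub>R x" "t *\<^sub>R y"] by (simp add: scale)
  qed simp
  then have "continuous_on UNIV N"
    by (intro convex_on_continuous) auto
  then have "continuous_on (sphere 0 1) N"
    by (rule continuous_on_subset) simp
  moreover have "sphere (0 :: real^3^3) 1 \<noteq> {}"
    by simp
  ultimately obtain M0 where M0: "norm M0 = 1" "\<And>M. norm M = 1 \<Longrightarrow> N M0 \<le> N M"
    using continuous_attains_inf[of "sphere (0 :: real^3^3) 1" N] by (auto simp: dist_norm)
  have "M0 \<noteq> 0"
    using M0(1) by auto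
  then have "0 < N M0"
    using nonneg[of M0] zero[of M0] by linarith
  have norm_le: "N M0 * norm M \<le> N M" for M
  proof (cases "M = 0")
    case False
    then have "N M0 \<le> N ((1 / norm M) *\<^sub>R M)"
      by (intro M0(2)) simp
    then show ?thesis
      using False by (simp add: scale field_simps)
  qed (simp add: nonneg)
  show thesis
  proof
    show "0 < N M0 / 2"
      using \<open>0 < N M0\<close> by simp
    fix M :: "real^3^3"
    have entry: "\<bar>M $ i $ j\<bar> \<le> norm M" for i j
      by (rule order_trans[OF component_le_norm_cart Finite_Cartesian_Product.norm_nth_le])
    have "cmod (test_entry M) \<le> \<bar>M $ 1 $ 1\<bar> + \<bar>M $ 2 $ 1\<bar>"
      using cmod_le[of "test_entry M"] by simp
    then have "cmod (test_entry M) \<le> 2 * norm M"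
      using entry[of 1 1] entry[of 2 1] by linarith
    then have "N M0 / 2 * cmod (test_entry M) \<le> N M0 * norm M"
      using \<open>0 < N M0\<close> mult_left_mono[of "cmod (test_entry M)" "2 * norm M" "N M0 / 2"] by simp
    then show "N M0 / 2 * cmod (test_entry M) \<le> N M"
      using norm_le[of M] by linarith
  qed
qed

text \<open>Requiring \<open>D\<close> to be a natural number in the auxiliary property \<open>P\<close> turns the existential quantifier
  into a countable union, so that \<open>P\<close> is Borel and Fubini's theorem applies.\<close>

lemma AE_torus3_test_entry:
  "AE (\<alpha>, \<beta>, \<gamma>) in torus3. \<exists>D>0. \<forall>I\<in>multi_indices.
     (1 / D) ^ (multi_length I)\<^sup>2 \<le> cmod (test_entry (W I \<alpha> \<beta> \<gamma> - C))"
proof -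
  define T :: "real set" where "T = {0..<2*pi}"
  define F where "F I x = cmod (test_entry (W I (fst x) (fst (snd x)) (snd (snd x)) - C))" for I x
  define P where "P x \<longleftrightarrow> (\<exists>k::nat. 0 < k \<and> (\<forall>I\<in>multi_indices. (1 / k) ^ (multi_length I)\<^sup>2 \<le> F I x))" for x
  have T [measurable]: "T \<in> sets borel"
    by (simp add: T_def)
  have box: "T \<times> T \<times> T \<in> sets borel"
    by (intro borel_Times T)
  have [measurable]: "F I \<in> borel_measurable borel" for I
    unfolding F_def[abs_def] complex_norm
    by (intro borel_measurable_continuous_onI) (simp, intro continuous_intros continuous_on_W_nth)
  have "AE x in lborel. x \<in> T \<times> T \<times> T \<longrightarrow> P x"
  proof (rule AE_lborel_triple)
    have "{x. P x} \<in> sets borel"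
      unfolding P_def by measurable
    then have "- (T \<times> T \<times> T) \<union> {x. P x} \<in> sets borel"
      using box by (intro sets.Un) (auto simp: borel_comp)
    also have "- (T \<times> T \<times> T) \<union> {x. P x} = {x. x \<in> T \<times> T \<times> T \<longrightarrow> P x}"
      by auto
    finally show "{x. x \<in> T \<times> T \<times> T \<longrightarrow> P x} \<in> sets borel" .
    let ?R = "\<lambda>t. t \<in> T \<longrightarrow> (\<exists>D\<ge>1. \<forall>k::int. k \<noteq> 0 \<longrightarrow> (1 / D) ^ (nat \<bar>k\<bar>)\<^sup>2 \<le> 1 - cos (of_int k * t))"
    have R: "AE t in lborel. ?R t"
      using AE_one_minus_cos_lower_bound unfolding T_def .
    have *: "AE \<gamma> in lborel. (\<alpha>, \<beta>, \<gamma>) \<in> T \<times> T \<times> T \<longrightarrow> P (\<alpha>, \<beta>, \<gamma>)" if "?R \<alpha>" "?R \<beta>" for \<alpha> \<beta>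
    proof (cases "\<alpha> \<in> T \<and> \<beta> \<in> T")
      case True
      with that obtain D1 D2 where D: "1 \<le> D1" "1 \<le> D2"
        "\<And>k::int. k \<noteq> 0 \<Longrightarrow> (1 / D1) ^ (nat \<bar>k\<bar>)\<^sup>2 \<le> 1 - cos (of_int k * \<alpha>)"
        "\<And>k::int. k \<noteq> 0 \<Longrightarrow> (1 / D2) ^ (nat \<bar>k\<bar>)\<^sup>2 \<le> 1 - cos (of_int k * \<beta>)"
        by auto
      have "1 \<le> max D1 D2"
        using D by auto
      moreover have "(1 / max D1 D2) ^ n \<le> (1 / D1) ^ n" "(1 / max D1 D2) ^ n \<le> (1 / D2) ^ n" for n
        using D by (auto intro!: power_mono divide_left_mono simp: zero_less_mult_iff)
      then have "(1 / max D1 D2) ^ (nat \<bar>k\<bar>)\<^sup>2 \<le> 1 - cos (of_int k * \<alpha>)"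
          "(1 / max D1 D2) ^ (nat \<bar>k\<bar>)\<^sup>2 \<le> 1 - cos (of_int k * \<beta>)" if "k \<noteq> 0" for k :: int
        using D(3,4)[OF that] order_trans by blast+
      ultimately have "AE \<gamma> in lborel. \<gamma> \<in> {0..<2*pi} \<longrightarrow> (\<exists>D\<ge>1. \<forall>I\<in>multi_indices.
             (1 / D) ^ (multi_length I)\<^sup>2 \<le> cmod (test_entry (W I \<alpha> \<beta> \<gamma> - C)))"
        by (intro AE_test_entry_lower_bound[of "max D1 D2"])
      then show ?thesis
      proof (rule eventually_mono, intro impI)
        fix \<gamma> assume "\<gamma> \<in> {0..<2*pi} \<longrightarrow> (\<exists>D\<ge>1. \<forall>I\<in>multi_indices.
             (1 / D) ^ (multi_length I)\<^sup>2 \<le> cmod (test_entry (W I \<alpha> \<beta> \<gamma> - C)))" "(\<alpha>, \<beta>, \<gamma>) \<in> T \<times> T \<times> T"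
        then obtain D where D: "1 \<le> D" 
          "\<And>I. I \<in> multi_indices \<Longrightarrow> (1 / D) ^ (multi_length I)\<^sup>2 \<le> F I (\<alpha>, \<beta>, \<gamma>)"
          by (auto simp: T_def F_def)
        obtain k where k: "D \<le> real k"
          using real_arch_simple by blast
        have "(1 / real k) ^ n \<le> (1 / D) ^ n" for n
          using D(1) k by (intro power_mono divide_left_mono) auto
        then show "P (\<alpha>, \<beta>, \<gamma>)"
          unfolding P_def using D k by (intro exI[of _ k]) (fastforce intro: order_trans)
      qed
    qed auto
    show "AE \<alpha> in lborel. AE \<beta> in lborel. AE \<gamma> in lborel. (\<alpha>, \<beta>, \<gamma>) \<in> T \<times> T \<times> T \<longrightarrow> P (\<alpha>, \<beta>, \<gamma>)"
      by (rule eventually_mono[OF R], rule eventually_mono[OF R], rule *)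
  qed
  then have "AE x in lebesgue. x \<in> T \<times> T \<times> T \<longrightarrow> P x"
    by (rule AE_completion)
  then have "AE x in torus3. P x"
    using box unfolding torus3_def T_def
    by (subst AE_restrict_space_iff) auto
  then show ?thesis
  proof (rule eventually_mono)
    fix x assume "P x"
    then obtain k :: nat where "0 < k" "\<forall>I\<in>multi_indices. (1 / k) ^ (multi_length I)\<^sup>2 \<le> F I x"
      by (auto simp: P_def)
    then show "case x of (\<alpha>, \<beta>, \<gamma>) \<Rightarrow> \<exists>D>0. \<forall>I\<in>multi_indices.
        (1 / D) ^ (multi_length I)\<^sup>2 \<le> cmod (test_entry (W I \<alpha> \<beta> \<gamma> - C))"
      by (cases x) (auto simp: F_def intro!: exI[of _ "real k"])
  qed
qed

theorem theorem2:
  fixes C :: "real^3^3" and N :: "real^3^3 \<Rightarrow> real"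
  assumes "rotation_matrix C" and "matrix_norm N"
  shows "AE (\<alpha>, \<beta>, \<gamma>) in torus3.
           \<exists>D>0. \<forall>n::nat. n > 0 \<longrightarrow>
             (\<forall>I\<in>multi_indices. multi_length I = n \<longrightarrow>
               N (W I \<alpha> \<beta> \<gamma> - C) \<ge> D powi (- (int n)\<^sup>2))"
proof -
  obtain c where c: "0 < c" "\<And>M. c * cmod (test_entry M) \<le> N M"
    using matrix_norm_lower_bound[OF assms(2)] by blast
  define c' where "c' = min c 1"
  have c': "0 < c'" "c' \<le> c" "c' \<le> 1"
    using c by (auto simp: c'_def)
  have "\<exists>D>0. \<forall>n::nat. n > 0 \<longrightarrow> (\<forall>I\<in>multi_indices. multi_length I = n \<longrightarrow>
      D powi (- (int n)\<^sup>2) \<le> N (W I \<alpha> \<beta> \<gamma> - C))"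
    if "0 < D" "\<forall>I\<in>multi_indices. (1 / D) ^ (multi_length I)\<^sup>2 \<le> cmod (test_entry (W I \<alpha> \<beta> \<gamma> - C))"
    for D \<alpha> \<beta> \<gamma>
  \<comment> \<open>As \<open>n > 0\<close>, dividing \<open>D\<close> by \<open>c' \<le> 1\<close> gains at least one factor \<open>c'\<close>.\<close>
  proof (intro exI[of _ "D / c'"] conjI allI impI ballI)
    fix n I assume n: "0 < n" and I: "I \<in> multi_indices" "multi_length I = n"
    have "(D / c') powi (- (int n)\<^sup>2) = (c' * (1 / D)) ^ n\<^sup>2"
      by (simp add: power_int_minus power_divide flip: of_nat_power)
    also have "\<dots> = c' ^ n\<^sup>2 * (1 / D) ^ n\<^sup>2"
      by (rule power_mult_distrib)
    also have "\<dots> \<le> c * cmod (test_entry (W I \<alpha> \<beta> \<gamma> - C))"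
    proof (intro mult_mono)
      have "c' ^ n\<^sup>2 \<le> c' ^ 1"
        using c' n by (intro power_decreasing) (auto simp: Suc_le_eq)
      then show "c' ^ n\<^sup>2 \<le> c"
        using c' by simp
    qed (use that I c in auto)
    also have "\<dots> \<le> N (W I \<alpha> \<beta> \<gamma> - C)"
      by (rule c)
    finally show "(D / c') powi (- (int n)\<^sup>2) \<le> N (W I \<alpha> \<beta> \<gamma> - C)" .
  qed (use that c' in auto)
  with AE_torus3_test_entry[of C] show ?thesis
    by (elim eventually_mono) blast
qed

end
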